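(* Let $\mathfrak{g}$ be a finite-dimensional quadratic Lie algebra over $\mathbb{C}$. Let $\mathbf{x}$ be an element of $\mathfrak{g}_\infty$ such that $x_0$ is regular in $\mathfrak{g}$. Then for all pairs of natural numbers $(m,n)$ with $m\leq n$, $$\operatorname{mod}_{m,n}(\mathbf{x})=(n-m)\chi(\mathfrak{g}).$$
   Context: Natural numbers include $0$. A Lie algebra is quadratic if it admits a non-degenerate symmetric bilinear form $K$ that is invariant, i.e. $K([x,y],z)=K(x,[y,z])$ for all $x,y,z$. For a finite-dimensional complex Lie algebra $\mathfrak{g}$, let $\mathfrak{g}_\infty=\mathfrak{g}\otimes\mathbb{C}[T]$ be the Lie algebra with bracket extended $\mathbb{C}[T]$-bilinearly; its elements are written $\mathbf{x}=\sum_{k\in\mathbb{N}}x_k\otimes T^k$ with $x_k\in\mathfrak{g}$ (finitely many nonzero). For $m\in\mathbb{N}$ let $\mathfrak{g}_m=\mathfrak{g}_\infty/(\mathfrak{g}\otimes T^{m+1}\mathbb{C}[T])$ (the $m$-th generalized Takiff Lie algebra; $\mathfrak{g}_0=\mathfrak{g}$), and let $\mathbf{x}(m)=(x_0,\dots,x_m)$ be the image of $\mathbf{x}$ in $\mathfrak{g}_m$. For an element $z$ of a Lie algebra $\mathfrak{h}$, $\mathfrak{h}^z$ is its centralizer in $\mathfrak{h}$; for $f\in\mathfrak{h}^*$, $\mathfrak{h}^f=\{y\in\mathfrak{h}: f([y,\mathfrak{h}])=0\}$. The index of $\mathfrak{h}$ is $\chi(\mathfrak{h})=\min_{f\in\mathfrak{h}^*}\dim\mathfrak{h}^f$.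 For $m\le n$ in $\mathbb{N}$ and $\mathbf{x}\in\mathfrak{g}_\infty$, the $(m,n)$-modality of $\mathbf{x}$ is $$\operatorname{mod}_{m,n}(\mathbf{x})=\min_{\mathbf{y}\in\mathfrak{g}_\infty,\ \mathbf{y}(m)=\mathbf{x}(m)}\dim\mathfrak{g}_n^{\mathbf{y}(n)}-\dim\mathfrak{g}_m^{\mathbf{x}(m)}.$$ An element $x$ of the quadratic Lie algebra $\mathfrak{g}$ is regular if its centralizer $\mathfrak{g}^x$ has minimal dimension among centralizers of elements of $\mathfrak{g}$; equivalently $\dim\mathfrak{g}^x=\chi(\mathfrak{g})$. *)

theory Defs
  imports Complex_Main "HOL-Computational_Algebra.Polynomial"
begin

locale lie_algebra = vector_space scaleC
  for scaleC :: "complex \<Rightarrow> 'a::ab_group_add \<Rightarrow> 'a" +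
  fixes bracket :: "'a \<Rightarrow> 'a \<Rightarrow> 'a"
  assumes linear_left: "Vector_Spaces.linear scaleC scaleC (\<lambda>x. bracket x y)"
    and linear_right: "Vector_Spaces.linear scaleC scaleC (bracket x)"
    and alternating: "bracket x x = 0"
    and jacobi: "bracket x (bracket y z) + bracket y (bracket z x) + bracket z (bracket x y) = 0"

locale fin_dim_lie_algebra = lie_algebra scaleC bracket
  for scaleC :: "complex \<Rightarrow> 'a::ab_group_add \<Rightarrow> 'a" and bracket +
  assumes fin_dim: "\<exists>B. finite B \<and> span B = UNIV"

definition quadratic :: "(complex \<Rightarrow> 'a::ab_group_add \<Rightarrow> 'a) \<Rightarrow> ('a \<Rightarrow> 'a \<Rightarrow> 'a) \<Rightarrow> bool" where
  "quadratic scaleC bracket \<longleftrightarrow>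
     (\<exists>K :: 'a \<Rightarrow> 'a \<Rightarrow> complex.
        (\<forall>y. Vector_Spaces.linear scaleC (*) (\<lambda>x. K x y)) \<and>
        (\<forall>x. Vector_Spaces.linear scaleC (*) (K x)) \<and>
        (\<forall>x y. K x y = K y x) \<and>
        (\<forall>x. (\<forall>y. K x y = 0) \<longrightarrow> x = 0) \<and>
        (\<forall>x y z. K (bracket x y) z = K x (bracket y z)))"

text \<open>The centralizer of \<open>z\<close> in the Lie algebra with underlying set \<open>\<h>\<close>.\<close>

definition lie_centralizer :: "'v set \<Rightarrow> ('v \<Rightarrow> 'v \<Rightarrow> 'v::zero) \<Rightarrow> 'v \<Rightarrow> 'v set" where
  "lie_centralizer \<h> bracket z = {y \<in> \<h>. bracket y z = 0}"

definition coadjoint_stabilizer :: "('a \<Rightarrow> 'a \<Rightarrow> 'a) \<Rightarrow> ('a \<Rightarrow> complex) \<Rightarrow> 'a set" where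
  "coadjoint_stabilizer bracket f = {y. \<forall>z. f (bracket y z) = 0}"

text \<open>On \<^typ>\<open>nat\<close>, \<open>INF\<close> over a nonempty family is its minimum.\<close>

definition lie_index :: "(complex \<Rightarrow> 'a::ab_group_add \<Rightarrow> 'a) \<Rightarrow> ('a \<Rightarrow> 'a \<Rightarrow> 'a) \<Rightarrow> nat" where
  "lie_index scaleC bracket =
     (INF f \<in> {f. Vector_Spaces.linear scaleC (*) f}.
        vector_space.dim scaleC (coadjoint_stabilizer bracket f))"

definition regular_element ::
    "(complex \<Rightarrow> 'a::ab_group_add \<Rightarrow> 'a) \<Rightarrow> ('a \<Rightarrow> 'a \<Rightarrow> 'a) \<Rightarrow> 'a \<Rightarrow> bool" where
  "regular_element scaleC bracket x \<longleftrightarrow>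
     (\<forall>y. vector_space.dim scaleC (lie_centralizer UNIV bracket x)
           \<le> vector_space.dim scaleC (lie_centralizer UNIV bracket y))"

text \<open>
  The type \<^typ>\<open>'a poly\<close> of finitely supported sequences in \<^typ>\<open>'a\<close> plays the role of
  \<open>\<g> \<otimes> \<complex>[T]\<close>: the element \<open>\<Sum>k. x\<^sub>k \<otimes> T^k\<close> is the polynomial whose \<open>k\<close>-th coefficient
  is \<open>x\<^sub>k\<close>. No multiplication on \<^typ>\<open>'a\<close> is involved.
\<close>

definition poly_scale :: "(complex \<Rightarrow> 'a::ab_group_add \<Rightarrow> 'a) \<Rightarrow> complex \<Rightarrow> 'a poly \<Rightarrow> 'a poly" where
  "poly_scale scaleC c = map_poly (scaleC c)"

definition poly_bracket :: "('a \<Rightarrow> 'a \<Rightarrow> 'a::ab_group_add) \<Rightarrow> 'a poly \<Rightarrow> 'a poly \<Rightarrow> 'a poly" where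
  "poly_bracket bracket x y =
     (\<Sum>i\<le>degree x. \<Sum>j\<le>degree y. monom (bracket (coeff x i) (coeff y j)) (i + j))"

text \<open>
  The quotient \<open>\<g>\<^sub>m = (\<g> \<otimes> \<complex>[T]) / (\<g> \<otimes> T^(m+1) \<complex>[T])\<close> is represented by the truncated
  polynomials \<open>(x\<^sub>0, \<dots>, x\<^sub>m)\<close>, on which the scalar multiplication is \<^const>\<open>poly_scale\<close>. The
  lemmas at the end of this theory say that \<open>takiff_proj m\<close> is a surjective homomorphism onto it
  whose kernel is \<open>\<g> \<otimes> T^(m+1) \<complex>[T]\<close>.
\<close>

definition takiff :: "nat \<Rightarrow> 'a::zero poly set" where
  "takiff m = {x. degree x \<le> m}"

definition takiff_proj :: "nat \<Rightarrow> 'a::zero poly \<Rightarrow> 'a poly" where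
  "takiff_proj m x = poly_cutoff (Suc m) x"

definition takiff_bracket ::
    "nat \<Rightarrow> ('a \<Rightarrow> 'a \<Rightarrow> 'a::ab_group_add) \<Rightarrow> 'a poly \<Rightarrow> 'a poly \<Rightarrow> 'a poly" where
  "takiff_bracket m bracket x y = takiff_proj m (poly_bracket bracket x y)"

definition takiff_centralizer_dim ::
    "(complex \<Rightarrow> 'a::ab_group_add \<Rightarrow> 'a) \<Rightarrow> ('a \<Rightarrow> 'a \<Rightarrow> 'a) \<Rightarrow> nat \<Rightarrow> 'a poly \<Rightarrow> nat" where
  "takiff_centralizer_dim scaleC bracket m x =
     vector_space.dim (poly_scale scaleC)
       (lie_centralizer (takiff m) (takiff_bracket m bracket) (takiff_proj m x))"

definition modality ::
    "(complex \<Rightarrow> 'a::ab_group_add \<Rightarrow> 'a) \<Rightarrow> ('a \<Rightarrow> 'a \<Rightarrow> 'a) \<Rightarrow> nat \<Rightarrow> nat \<Rightarrow> 'a poly \<Rightarrow> int" where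
  "modality scaleC bracket m n x =
     int (INF y \<in> {y. takiff_proj m y = takiff_proj m x}. takiff_centralizer_dim scaleC bracket n y)
     - int (takiff_centralizer_dim scaleC bracket m x)"


lemma coeff_takiff_proj: "coeff (takiff_proj m x) k = (if k \<le> m then coeff x k else 0)"
  by (simp add: takiff_proj_def coeff_poly_cutoff less_Suc_eq_le)

lemma mem_takiff_iff: "x \<in> takiff m \<longleftrightarrow> (\<forall>k>m. coeff x k = 0)"
  unfolding takiff_def by (auto simp: coeff_eq_0 intro: degree_le)

lemma range_takiff_proj: "range (takiff_proj m) = (takiff m :: 'a::zero poly set)"
proof -
  have "x = takiff_proj m x" if "x \<in> takiff m" for x :: "'a poly"
    using that by (auto simp: poly_eq_iff coeff_takiff_proj mem_takiff_iff)
  then have "(takiff m :: 'a poly set) \<subseteq> range (takiff_proj m)"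
    by blast
  moreover have "range (takiff_proj m) \<subseteq> (takiff m :: 'a poly set)"
    by (auto simp: mem_takiff_iff coeff_takiff_proj)
  ultimately show ?thesis
    by blast
qed

lemma takiff_proj_eq_iff:
  "takiff_proj m x = takiff_proj m y \<longleftrightarrow> (\<forall>k\<le>m. coeff x k = coeff y k)"
  by (auto simp: poly_eq_iff coeff_takiff_proj)

context lie_algebra
begin

lemma bracket_zero [simp]: "bracket 0 y = 0" "bracket x 0 = 0"
  using linear_left linear_right
  by (metis Vector_Spaces.linear.axioms(3) module_hom.zero)+

lemma bracket_add: "bracket (x + x') y = bracket x y + bracket x' y"
    "bracket x (y + y') = bracket x y + bracket x y'"
  using linear_left[of y] linear_right[of x]
  by (simp_all add: Vector_Spaces.linear_iff)

lemma bracket_scale: "bracket (scaleC c x) y = scaleC c (bracket x y)"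
    "bracket x (scaleC c y) = scaleC c (bracket x y)"
  using linear_left[of y] linear_right[of x]
  by (simp_all add: Vector_Spaces.linear_iff)

lemma bracket_sum: "bracket x (sum f A) = (\<Sum>a\<in>A. bracket x (f a))"
  by (induction A rule: infinite_finite_induct) (simp_all add: bracket_add)

lemma bracket_minus: "bracket x y = - bracket y x"
proof -
  have "bracket x y + bracket y x = bracket (x + y) (x + y)"
    by (simp add: bracket_add alternating[of x] alternating[of y])
  also have "\<dots> = 0"
    by (rule alternating)
  finally have "bracket x y + bracket y x = 0" .
  then show ?thesis
    by (simp only: eq_neg_iff_add_eq_0)
qed

lemma coeff_poly_scale: "coeff (poly_scale scaleC c x) k = scaleC c (coeff x k)"
  by (simp add: poly_scale_def coeff_map_poly)

lemma coeff_poly_bracket: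
  "coeff (poly_bracket bracket x y) k = (\<Sum>i\<le>k. bracket (coeff x i) (coeff y (k - i)))"
proof -
  let ?b = "\<lambda>i j. bracket (coeff x i) (coeff y j)"
  have inner: "(\<Sum>j\<le>degree y. if i + j = k then ?b i j else 0) = (if i \<le> k then ?b i (k - i) else 0)"
    for i
  proof -
    have "(\<Sum>j\<le>degree y. if i + j = k then ?b i j else 0)
        = (\<Sum>j\<le>degree y. if j = k - i then (if i \<le> k then ?b i (k - i) else 0) else 0)"
      by (intro sum.cong) auto
    also have "\<dots> = (if i \<le> k then ?b i (k - i) else 0)"
      by (auto simp: coeff_eq_0)
    finally show ?thesis .
  qed
  have "coeff (poly_bracket bracket x y) k = (\<Sum>i\<le>degree x. if i \<le> k then ?b i (k - i) else 0)"
    by (simp add: poly_bracket_def coeff_sum inner)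
  also have "\<dots> = (\<Sum>i\<le>max k (degree x). if i \<le> k then ?b i (k - i) else 0)"
    by (intro sum.mono_neutral_left) (auto simp: coeff_eq_0)
  also have "\<dots> = (\<Sum>i\<le>k. if i \<le> k then ?b i (k - i) else 0)"
    by (intro sum.mono_neutral_right) auto
  finally show ?thesis by simp
qed

lemma coeff_poly_bracket_bracket:
  "coeff (poly_bracket bracket x (poly_bracket bracket y z)) k =
     (\<Sum>(i, j, l) \<in> {(i, j, l). i + j + l = k}. bracket (coeff x i) (bracket (coeff y j) (coeff z l)))"
proof -
  have "coeff (poly_bracket bracket x (poly_bracket bracket y z)) k =
      (\<Sum>(i, j) \<in> (SIGMA i:{..k}. {..k - i}).
        bracket (coeff x i) (bracket (coeff y j) (coeff z (k - i - j))))"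
    by (simp add: coeff_poly_bracket bracket_sum sum.Sigma)
  also have "\<dots> = (\<Sum>(i, j, l) \<in> {(i, j, l). i + j + l = k}.
      bracket (coeff x i) (bracket (coeff y j) (coeff z l)))"
    by (rule sum.reindex_bij_witness[where i = "\<lambda>(i, j, l). (i, j)"
          and j = "\<lambda>(i, j). (i, j, k - i - j)"]) auto
  finally show ?thesis .
qed

lemma poly_lie_algebra: "lie_algebra (poly_scale scaleC) (poly_bracket bracket)"
proof -
  have vs: "vector_space (poly_scale scaleC)"
    by unfold_locales (simp_all add: poly_eq_iff coeff_poly_scale scale_right_distrib
        scale_left_distrib)
  show ?thesis
  proof (intro lie_algebra.intro lie_algebra_axioms.intro vs)
    show "Vector_Spaces.linear (poly_scale scaleC) (poly_scale scaleC) (\<lambda>x. poly_bracket bracket x y)"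
      for y
      by (auto simp: Vector_Spaces.linear_iff vs poly_eq_iff coeff_poly_bracket coeff_poly_scale
          bracket_add bracket_scale sum.distrib scale_sum_right)
    show "Vector_Spaces.linear (poly_scale scaleC) (poly_scale scaleC) (poly_bracket bracket x)" for x
      by (auto simp: Vector_Spaces.linear_iff vs poly_eq_iff coeff_poly_bracket coeff_poly_scale
          bracket_add bracket_scale sum.distrib scale_sum_right)
    show "poly_bracket bracket x x = 0" for x
    proof (rule poly_eqI)
      fix k
      let ?S = "\<Sum>i\<le>k. bracket (coeff x i) (coeff x (k - i))"
      have "?S = (\<Sum>i\<le>k. bracket (coeff x (k - i)) (coeff x i))"
        by (rule sum.reindex_bij_witness[where i = "\<lambda>i. k - i" and j = "\<lambda>i. k - i"]) auto
      also have "\<dots> = (\<Sum>i\<le>k. - bracket (coeff x i) (coeff x (k - i)))"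
        by (intro sum.cong bracket_minus refl)
      also have "\<dots> = - ?S"
        by (simp add: sum_negf)
      finally have "?S + ?S = 0"
        by (simp only: eq_neg_iff_add_eq_0)
      moreover have "?S + ?S = scaleC 2 ?S"
        using scale_left_distrib[of 1 1 ?S] by simp
      ultimately have "scaleC 2 ?S = 0" by simp
      then have "?S = 0" by (simp only: scale_eq_0_iff) simp
      then show "coeff (poly_bracket bracket x x) k = coeff 0 k"
        by (simp add: coeff_poly_bracket)
    qed
    show "poly_bracket bracket x (poly_bracket bracket y z)
        + poly_bracket bracket y (poly_bracket bracket z x)
        + poly_bracket bracket z (poly_bracket bracket x y) = 0" for x y z
    proof (rule poly_eqI)
      fix k
      let ?T = "{(i, j, l). i + j + l = (k::nat)}"
      have 1: "coeff (poly_bracket bracket y (poly_bracket bracket z x)) k =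
          (\<Sum>(i, j, l) \<in> ?T. bracket (coeff y j) (bracket (coeff z l) (coeff x i)))"
        unfolding coeff_poly_bracket_bracket
        by (rule sum.reindex_bij_witness[where i = "\<lambda>(i, j, l). (j, l, i)"
              and j = "\<lambda>(j, l, i). (i, j, l)"]) auto
      have 2: "coeff (poly_bracket bracket z (poly_bracket bracket x y)) k =
          (\<Sum>(i, j, l) \<in> ?T. bracket (coeff z l) (bracket (coeff x i) (coeff y j)))"
        unfolding coeff_poly_bracket_bracket
        by (rule sum.reindex_bij_witness[where i = "\<lambda>(i, j, l). (l, i, j)"
              and j = "\<lambda>(l, i, j). (i, j, l)"]) auto
      show "coeff (poly_bracket bracket x (poly_bracket bracket y z)
          + poly_bracket bracket y (poly_bracket bracket z x)
          + poly_bracket bracket z (poly_bracket bracket x y)) k = coeff 0 k"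
        unfolding coeff_add 1 2 coeff_poly_bracket_bracket[of x y z]
        by (simp add: sum.distrib[symmetric] case_prod_unfold jacobi)
    qed
  qed
qed

lemma takiff_proj_linear:
  "Vector_Spaces.linear (poly_scale scaleC) (poly_scale scaleC) (takiff_proj m)"
proof -
  interpret P: lie_algebra "poly_scale scaleC" "poly_bracket bracket"
    by (rule poly_lie_algebra)
  show ?thesis
    by (auto simp: Vector_Spaces.linear_iff P.vector_space_axioms poly_eq_iff coeff_takiff_proj
        coeff_poly_scale)
qed

lemma takiff_proj_bracket:
  "takiff_proj m (poly_bracket bracket x y) =
     takiff_bracket m bracket (takiff_proj m x) (takiff_proj m y)"
  by (auto simp: takiff_bracket_def poly_eq_iff coeff_takiff_proj coeff_poly_bracket
      intro!: sum.cong)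

lemma takiff_proj_kernel: "takiff_proj m x = 0 \<longleftrightarrow> (\<forall>k\<le>m. coeff x k = 0)"
  by (auto simp: poly_eq_iff coeff_takiff_proj)

end

end

theory Submission
  imports Defs
begin

text \<open>
  The modality is a difference of centralizer dimensions, so it suffices to show that for every
  \<open>y\<close> in \<open>\<g> \<otimes> \<complex>[T]\<close> with regular constant term \<open>y\<^sub>0\<close>, the centralizer of \<open>y\<close> in \<open>\<g>\<^sub>n\<close> has
  dimension \<open>(n + 1) r\<close>, where \<open>r\<close> is the dimension of the centralizer of \<open>y\<^sub>0\<close> in \<open>\<g>\<close>
  (\<open>takiff_centralizer_dim_regular\<close>), and that
  \<open>r = \<chi>(\<g>)\<close> (\<open>quadratic_lie_index\<close>). As only \<open>y\<^sub>0\<close> enters, the minimum in the modality is then taken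
  over a constant.

  The dimension grows by \<open>r\<close> with each power of \<open>T\<close>: taking the constant term maps the annihilator
  of \<open>y\<close> modulo \<open>T^(n+1)\<close> to the centralizer of \<open>y\<^sub>0\<close>, with kernel \<open>T\<close> times the annihilator modulo \<open>T^n\<close>.
  The point is that this map is onto, so that every \<open>v\<close> commuting with \<open>y\<^sub>0\<close> lifts to arbitrarily high
  order (\<open>regular_centralizer_lift\<close>). If \<open>z\<close> is a lift up to order \<open>n - 1\<close>, then \<open>[z, y]\<close> is
  \<open>T^n q\<close> for some \<open>q\<close>, and a coefficient of degree \<open>n\<close> can be added to \<open>z\<close> so as to lift one order
  further exactly if the obstruction \<open>q\<^sub>0\<close> lies in \<open>[\<g>, y\<^sub>0]\<close>.

  Regularity removes the obstruction (\<open>regular_obstruction_in_range\<close>). For a number \<open>t \<noteq> 0\<close>, the value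
  \<open>q(t) = t^(-n) [z(t), y(t)]\<close> lies in \<open>[\<g>, y(t)]\<close>. Were \<open>q\<^sub>0\<close> outside \<open>[\<g>, y\<^sub>0]\<close>, then \<open>q(t)\<close> together
  with \<open>[w\<^sub>i, y(t)]\<close>, where the \<open>[w\<^sub>i, y\<^sub>0]\<close> form a basis of \<open>[\<g>, y\<^sub>0]\<close>, would be independent at \<open>t = 0\<close>
  and hence for small \<open>t \<noteq> 0\<close> (\<open>exists_independent_poly_eval\<close>). So \<open>[\<g>, y(t)]\<close> would be larger than
  \<open>[\<g>, y\<^sub>0]\<close>, and by rank-nullity the centralizer of \<open>y(t)\<close> smaller than that of \<open>y\<^sub>0\<close>.
\<close>

section \<open>Linear algebra\<close>

lemma (in vector_space) span_Int_span_of_disjoint: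
  assumes B: "independent B" and sub: "C \<subseteq> B" "D \<subseteq> B" and disj: "C \<inter> D = {}"
    and v: "v \<in> span C" "v \<in> span D"
  shows "v = 0"
proof -
  have "representation B v b = 0" for b
  proof (rule ccontr)
    assume ne: "representation B v b \<noteq> 0"
    have "representation B v = representation C v" "representation B v = representation D v"
      using representation_extend[OF B v(1) sub(1)] representation_extend[OF B v(2) sub(2)] by auto
    then have "b \<in> C" "b \<in> D"
      using ne representation_ne_zero by metis+
    then show False
      using disj by auto
  qed
  moreover have "v \<in> span B"
    using v(1) span_mono[OF sub(1)] by auto
  ultimately show ?thesis
    using sum_nonzero_representation_eq[OF B, of v] by simp
qed

text \<open>
  Rank-nullity on a finite-dimensional subspace of a possibly infinite-dimensional space, as needed
  for truncated polynomials among all polynomials: if a basis \<open>C\<close> of the kernel is extended to a basis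
  \<open>B\<close>, then \<open>f\<close> maps \<open>B - C\<close> injectively onto a basis of the image.
\<close>

lemma (in vector_space_pair) dim_image_add_dim_kernel:
  assumes f: "Vector_Spaces.linear s1 s2 f"
    and V: "vs1.subspace V" and fin: "finite F" "V \<subseteq> vs1.span F"
  shows "vs1.dim V = vs2.dim (f ` V) + vs1.dim {v \<in> V. f v = 0}"
proof -
  interpret f: Vector_Spaces.linear s1 s2 f
    by (rule f)
  let ?N = "{v \<in> V. f v = 0}"
  have N: "vs1.subspace ?N"
    using vs1.subspace_inter[OF V f.subspace_kernel] by (simp add: Int_def)
  obtain C where C: "C \<subseteq> ?N" "vs1.independent C" "?N \<subseteq> vs1.span C"
    by (rule vs1.maximal_independent_subset)
  obtain B where B: "C \<subseteq> B" "B \<subseteq> V" "vs1.independent B" "V \<subseteq> vs1.span B"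
    using vs1.maximal_independent_subset_extend[of C V] C(1,2) by blast
  have finB: "finite B"
    using vs1.independent_span_bound[OF fin(1) B(3)] B(2) fin(2) by auto
  have spanV: "vs1.span B = V" and spanN: "vs1.span C = ?N"
    using vs1.span_subspace[OF B(2,4) V] vs1.span_subspace[OF C(1,3) N] by auto
  have inj: "inj_on f (vs1.span (B - C))"
  proof -
    have "v = 0" if v: "v \<in> vs1.span (B - C)" and "f v = 0" for v
    proof (rule vs1.span_Int_span_of_disjoint[OF B(3), of C "B - C"])
      show "v \<in> vs1.span C"
        using vs1.span_mono[of "B - C" B] that by (auto simp: spanN spanV)
    qed (use B v in auto)
    then show ?thesis
      using f.inj_on_iff_eq_0[OF vs1.subspace_span] by blast
  qed
  have "f ` (B - C) \<subseteq> f ` V"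
    using B(2) by auto
  moreover have "f ` V \<subseteq> vs2.span (f ` (B - C))"
  proof -
    have "f b \<in> vs2.span (f ` (B - C))" if "b \<in> B" for b
    proof (cases "b \<in> C")
      case True
      then have "f b = 0"
        using C(1) by auto
      then show ?thesis
        by (simp add: vs2.span_zero)
    qed (use that in \<open>auto intro: vs2.span_base\<close>)
    then have "vs2.span (f ` B) \<subseteq> vs2.span (f ` (B - C))"
      by (intro vs2.span_minimal) auto
    then show ?thesis
      using f.span_image[of B] spanV by simp
  qed
  moreover have "vs2.independent (f ` (B - C))"
    by (intro f.independent_injective_image inj vs1.independent_mono[OF B(3)]) auto
  ultimately have "vs2.dim (f ` V) = card (f ` (B - C))"
    by (intro vs2.dim_unique) auto
  also have "\<dots> = card (B - C)"
    by (intro card_image inj_on_subset[OF inj] vs1.span_superset)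
  finally have "vs2.dim (f ` V) = card B - card C"
    using B(1) finB by (simp add: card_Diff_subset finite_subset)
  moreover have "vs1.dim V = card B" "vs1.dim ?N = card C"
    using vs1.dim_unique[OF B(2,4,3)] vs1.dim_unique[OF C(1,3,2)] by auto
  ultimately show ?thesis
    using card_mono[OF finB B(1)] by simp
qed

section \<open>Evaluating polynomials with vector coefficients\<close>

definition poly_eval :: "('c::field \<Rightarrow> 'v \<Rightarrow> 'v::ab_group_add) \<Rightarrow> 'c \<Rightarrow> 'v poly \<Rightarrow> 'v" where
  "poly_eval scale t p = (\<Sum>k\<le>degree p. scale (t ^ k) (coeff p k))"

context vector_space
begin

lemma poly_eval_altdef:
  assumes "degree p \<le> n"
  shows "poly_eval scale t p = (\<Sum>k\<le>n. scale (t ^ k) (coeff p k))"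
  unfolding poly_eval_def using assms
  by (intro sum.mono_neutral_left) (auto simp: coeff_eq_0)

lemma poly_eval_0 [simp]: "poly_eval scale t 0 = 0"
  by (simp add: poly_eval_def)

lemma poly_eval_add: "poly_eval scale t (p + q) = poly_eval scale t p + poly_eval scale t q"
proof -
  let ?n = "max (degree p) (degree q)"
  have "degree (p + q) \<le> ?n"
    by (rule degree_add_le_max)
  then show ?thesis
    by (simp add: poly_eval_altdef[of _ ?n] scale_right_distrib sum.distrib)
qed

lemma poly_eval_sum: "poly_eval scale t (sum f A) = (\<Sum>a\<in>A. poly_eval scale t (f a))"
  by (induction A rule: infinite_finite_induct) (simp_all add: poly_eval_add)

lemma poly_eval_monom: "poly_eval scale t (monom v k) = scale (t ^ k) v"
proof -
  have "poly_eval scale t (monom v k) = (\<Sum>i\<le>k. if i = k then scale (t ^ k) v else 0)"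
    by (subst poly_eval_altdef[OF degree_monom_le]) (intro sum.cong, auto)
  then show ?thesis
    by simp
qed

lemma poly_eval_poly_shift:
  assumes "\<And>k. k < n \<Longrightarrow> coeff p k = 0"
  shows "poly_eval scale t p = scale (t ^ n) (poly_eval scale t (poly_shift n p))"
proof -
  have deg: "degree (poly_shift n p) \<le> degree p"
    by (rule degree_le) (auto simp: coeff_poly_shift coeff_eq_0)
  have "poly_eval scale t p = (\<Sum>k\<le>degree p + n. scale (t ^ k) (coeff p k))"
    by (rule poly_eval_altdef) simp
  also have "\<dots> = (\<Sum>k\<in>{n..degree p + n}. scale (t ^ k) (coeff p k))"
    using assms by (intro sum.mono_neutral_right) auto
  also have "\<dots> = (\<Sum>k\<le>degree p. scale (t ^ (k + n)) (coeff p (k + n)))"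
    by (rule sum.reindex_bij_witness[where i = "\<lambda>k. k + n" and j = "\<lambda>k. k - n"]) auto
  also have "\<dots> = scale (t ^ n) (poly_eval scale t (poly_shift n p))"
    by (simp add: poly_eval_altdef[OF deg] coeff_poly_shift scale_sum_right power_add ac_simps)
  finally show ?thesis .
qed

end

text \<open>
  Linear independence is an open condition. For functionals \<open>\<phi> u\<close> dual to \<open>I\<close>, the matrix
  \<open>\<phi> u (p v (t))\<close> tends to the identity as \<open>t\<close> tends to \<open>0\<close>. Once it is close enough to be
  diagonally dominant, a linear relation among the \<open>p v (t)\<close> fails in the row of its largest
  coefficient, unless all coefficients vanish.
\<close>

lemma exists_independent_poly_eval:
  fixes scaleC :: "complex \<Rightarrow> 'a::ab_group_add \<Rightarrow> 'a"
  assumes vs: "vector_space scaleC"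
    and fin: "finite I" and indep: "\<not> module.dependent scaleC I"
    and p0: "\<And>v. v \<in> I \<Longrightarrow> coeff (p v) 0 = v"
  shows "\<exists>t. t \<noteq> 0 \<and> inj_on (\<lambda>v. poly_eval scaleC t (p v)) I \<and>
    \<not> module.dependent scaleC ((\<lambda>v. poly_eval scaleC t (p v)) ` I)"
proof -
  interpret vector_space scaleC
    by (rule vs)
  interpret C: vector_space "(*) :: complex \<Rightarrow> complex \<Rightarrow> complex"
    by unfold_locales (auto simp: algebra_simps)
  interpret VC: vector_space_pair scaleC "(*) :: complex \<Rightarrow> complex \<Rightarrow> complex"
    by unfold_locales
  have "\<exists>\<phi>. Vector_Spaces.linear scaleC (*) \<phi> \<and> (\<forall>v\<in>I. \<phi> v = (if v = u then 1 else 0))" for u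
    by (rule VC.linear_independent_extend[OF indep])
  then obtain \<phi> where lin: "\<And>u. Vector_Spaces.linear scaleC (*) (\<phi> u)"
    and dual: "\<And>u v. v \<in> I \<Longrightarrow> \<phi> u v = (if v = u then 1 else 0)"
    by metis
  have \<phi>_sum: "\<phi> u (sum f A) = (\<Sum>a\<in>A. \<phi> u (f a))" for u A and f :: "'c \<Rightarrow> 'a"
    by (rule VC.linear_sum[OF lin])
  have \<phi>_scale: "\<phi> u (scaleC c w) = c * \<phi> u w" for u c w
    by (rule VC.linear_scale[OF lin])
  define M where "M t u v = \<phi> u (poly_eval scaleC t (p v))" for t u v
  have M_lim: "((\<lambda>t. M t u v) \<longlongrightarrow> (if v = u then 1 else 0)) (at 0)" if "v \<in> I" for u v
  proof -
    have "((\<lambda>t. \<Sum>k\<le>degree (p v). t ^ k * \<phi> u (coeff (p v) k))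
        \<longlongrightarrow> (\<Sum>k\<le>degree (p v). 0 ^ k * \<phi> u (coeff (p v) k))) (at 0)"
      by (intro tendsto_intros)
    moreover have "(\<Sum>k\<le>degree (p v). 0 ^ k * \<phi> u (coeff (p v) k)) = \<phi> u v"
      by (subst sum.atMost_shift) (simp add: p0[OF that])
    ultimately show ?thesis
      using that by (simp add: M_def poly_eval_def \<phi>_sum \<phi>_scale dual)
  qed
  \<comment> \<open>With errors below this \<open>\<epsilon>\<close>, each row of \<open>M t\<close> differs from the identity by less than 1 in sum.\<close>
  define \<epsilon> :: real where "\<epsilon> = 1 / (real (card I) + 1)"
  have "\<epsilon> > 0"
    by (simp add: \<epsilon>_def add_pos_nonneg)
  have "eventually (\<lambda>t. \<forall>u\<in>I. \<forall>v\<in>I. dist (M t u v) (if v = u then 1 else 0) < \<epsilon>) (at 0)"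
    by (intro eventually_ball_finite[OF fin] ballI tendstoD[OF M_lim] \<open>\<epsilon> > 0\<close>)
  then have "eventually (\<lambda>t. t \<noteq> 0 \<and> (\<forall>u\<in>I. \<forall>v\<in>I. dist (M t u v) (if v = u then 1 else 0) < \<epsilon>)) (at 0)"
    using eventually_neq_at_within by (rule eventually_conj[rotated])
  then obtain t where "t \<noteq> 0"
    and close: "\<And>u v. u \<in> I \<Longrightarrow> v \<in> I \<Longrightarrow> dist (M t u v) (if v = u then 1 else 0) < \<epsilon>"
    using eventually_happens'[OF at_neq_bot] by blast
  let ?e = "\<lambda>v. poly_eval scaleC t (p v)"
  have coeffs_zero: "a v = 0" if rel: "(\<Sum>v\<in>I. scaleC (a v) (?e v)) = 0" and v: "v \<in> I" for a v
  proof -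
    have "Max ((\<lambda>v. cmod (a v)) ` I) \<in> (\<lambda>v. cmod (a v)) ` I"
      using v fin by (intro Max_in) auto
    then obtain u where u: "u \<in> I" "Max ((\<lambda>v. cmod (a v)) ` I) = cmod (a u)"
      by auto
    have max: "cmod (a v) \<le> cmod (a u)" if "v \<in> I" for v
      unfolding u(2)[symmetric] using that fin by (intro Max_ge) auto
    have "(\<Sum>v\<in>I. a v * M t u v) = \<phi> u (\<Sum>v\<in>I. scaleC (a v) (?e v))"
      by (simp add: \<phi>_sum \<phi>_scale M_def)
    then have "(\<Sum>v\<in>I. a v * M t u v) = 0"
      using rel VC.linear_0[OF lin] by simp
    then have "(\<Sum>v\<in>I. a v * ((if v = u then 1 else 0) - M t u v))
        = (\<Sum>v\<in>I. a v * (if v = u then 1 else 0))"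
      by (simp only: right_diff_distrib sum_subtractf) simp
    also have "\<dots> = a u"
      using u(1) fin by (simp add: if_distrib[of "(*) _"] cong: if_cong)
    finally have "cmod (a u) = cmod (\<Sum>v\<in>I. a v * ((if v = u then 1 else 0) - M t u v))"
      by simp
    also have "\<dots> \<le> (\<Sum>v\<in>I. cmod (a u) * \<epsilon>)"
    proof (rule sum_norm_le)
      fix v assume v: "v \<in> I"
      have "cmod ((if v = u then 1 else 0) - M t u v) \<le> \<epsilon>"
        using close[OF u(1) v] by (simp add: dist_norm norm_minus_commute)
      then show "cmod (a v * ((if v = u then 1 else 0) - M t u v)) \<le> cmod (a u) * \<epsilon>"
        unfolding norm_mult using max[OF v] by (intro mult_mono) auto
    qed
    also have "\<dots> = cmod (a u) * (real (card I) / (real (card I) + 1))"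
      by (simp add: \<epsilon>_def)
    finally have "cmod (a u) * (1 - real (card I) / (real (card I) + 1)) \<le> 0"
      by (simp add: algebra_simps)
    moreover have "1 - real (card I) / (real (card I) + 1) > 0"
      by (simp add: field_simps)
    ultimately have "cmod (a u) \<le> 0"
      by (simp add: mult_le_0_iff)
    then show ?thesis
      using max[OF v] by simp
  qed
  have inj: "inj_on ?e I"
  proof (rule inj_onI, rule ccontr)
    fix v w assume vw: "v \<in> I" "w \<in> I" "?e v = ?e w" "v \<noteq> w"
    let ?a = "\<lambda>u. if u = v then 1 else if u = w then - 1 else 0 :: complex"
    have "(\<Sum>u\<in>I. scaleC (?a u) (?e u)) = (\<Sum>u\<in>{v, w}. scaleC (?a u) (?e u))"
      using vw fin by (intro sum.mono_neutral_right) auto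
    also have "\<dots> = 0"
      using vw by simp
    finally have "?a v = 0"
      by (rule coeffs_zero) (rule vw)
    then show False
      by simp
  qed
  moreover have "independent (?e ` I)"
  proof (rule independent_if_scalars_zero)
    fix a w assume "(\<Sum>w\<in>?e ` I. scaleC (a w) w) = 0" "w \<in> ?e ` I"
    then show "a w = 0"
      using coeffs_zero[of "a \<circ> ?e"] by (auto simp: sum.reindex[OF inj])
  qed (use fin in auto)
  ultimately show ?thesis
    using \<open>t \<noteq> 0\<close> by auto
qed

section \<open>Centralizers of deformations of a regular element\<close>

context lie_algebra
begin

lemma bracket_poly_eval:
  "poly_eval scaleC t (poly_bracket bracket p q) = bracket (poly_eval scaleC t p) (poly_eval scaleC t q)"
proof -
  have bracket_sum_left: "bracket (sum f A) y = (\<Sum>a\<in>A. bracket (f a) y)" for f y and A :: "nat set"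
    by (induction A rule: infinite_finite_induct) (simp_all add: bracket_add)
  have "poly_eval scaleC t (poly_bracket bracket p q) =
      (\<Sum>i\<le>degree p. \<Sum>j\<le>degree q.
        bracket (scaleC (t ^ i) (coeff p i)) (scaleC (t ^ j) (coeff q j)))"
    by (simp add: poly_bracket_def poly_eval_sum poly_eval_monom bracket_scale power_add ac_simps)
  also have "\<dots> = (\<Sum>i\<le>degree p. bracket (scaleC (t ^ i) (coeff p i)) (poly_eval scaleC t q))"
    by (simp only: poly_eval_def[of scaleC t q] bracket_sum)
  also have "\<dots> = bracket (poly_eval scaleC t p) (poly_eval scaleC t q)"
    by (simp only: poly_eval_def[of scaleC t p] bracket_sum_left)
  finally show ?thesis .
qed

text \<open>
  Annihilators of \<open>x\<close> modulo \<open>T^n\<close>, represented by polynomials of degree less than \<open>n\<close>; for \<open>n > 0\<close> this is the centralizer of the image of \<open>x\<close> in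
  the Takiff algebra of level \<open>n - 1\<close>.
\<close>

definition truncated_centralizer :: "nat \<Rightarrow> 'a poly \<Rightarrow> 'a poly set" where
  "truncated_centralizer n x =
     {y. (\<forall>k\<ge>n. coeff y k = 0) \<and> (\<forall>k<n. coeff (poly_bracket bracket y x) k = 0)}"

lemma truncated_centralizer_0: "truncated_centralizer 0 x = {0}"
  by (auto simp: truncated_centralizer_def poly_eq_iff)

lemma coeff_poly_bracket_pCons_0:
  "coeff (poly_bracket bracket (pCons 0 y) x) k =
     (case k of 0 \<Rightarrow> 0 | Suc j \<Rightarrow> coeff (poly_bracket bracket y x) j)"
  by (cases k) (simp_all add: coeff_poly_bracket sum.atMost_Suc_shift del: sum.atMost_Suc)

text \<open>
  The bracket is \<open>\<complex>[T]\<close>-bilinear, so multiplication by \<open>T\<close>, which is \<open>pCons 0\<close>, shifts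
  the order to which \<open>y\<close> annihilates \<open>x\<close>.
\<close>

lemma truncated_centralizer_kernel_coeff_0:
  "{y \<in> truncated_centralizer (Suc n) x. coeff y 0 = 0} = pCons 0 ` truncated_centralizer n x"
proof (intro equalityI subsetI)
  fix y assume y: "y \<in> {y \<in> truncated_centralizer (Suc n) x. coeff y 0 = 0}"
  obtain a z where yz: "y = pCons a z"
    by (cases y) auto
  with y have a: "a = 0"
    by simp
  have "coeff z k = 0" if "k \<ge> n" for k
    using y that by (auto simp: truncated_centralizer_def yz a dest: spec[of _ "Suc k"])
  moreover have "coeff (poly_bracket bracket z x) k = 0" if "k < n" for k
    using y that
    by (auto simp: truncated_centralizer_def yz a coeff_poly_bracket_pCons_0 dest: spec[of _ "Suc k"])
  ultimately show "y \<in> pCons 0 ` truncated_centralizer n x"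
    by (auto simp: truncated_centralizer_def yz a)
qed (auto simp: truncated_centralizer_def coeff_poly_bracket_pCons_0 coeff_pCons split: nat.split)

end

context fin_dim_lie_algebra
begin

lemma dim_range_add_dim_centralizer:
  "dim (range (\<lambda>y. bracket y z)) + dim (lie_centralizer UNIV bracket z) = dim UNIV"
proof -
  interpret vector_space_pair scaleC scaleC
    by unfold_locales
  obtain F where "finite F" "span F = UNIV"
    using fin_dim by auto
  then show ?thesis
    using dim_image_add_dim_kernel[OF linear_left subspace_UNIV, of F z]
    by (simp add: lie_centralizer_def)
qed

text \<open>
  If \<open>y\<close> commutes with \<open>x\<close> up to order \<open>n - 1\<close> and the next coefficient of \<open>[y, x]\<close> were not in
  \<open>[\<g>, x\<^sub>0]\<close>, the range of the bracket with \<open>x(t)\<close> would have larger dimension for some \<open>t \<noteq> 0\<close> than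
  at \<open>t = 0\<close>, against the minimality of the centralizer of \<open>x\<^sub>0\<close>.
\<close>

lemma regular_obstruction_in_range:
  assumes reg: "regular_element scaleC bracket (coeff x 0)"
    and zero: "\<And>k. k < n \<Longrightarrow> coeff (poly_bracket bracket y x) k = 0"
  shows "coeff (poly_bracket bracket y x) n \<in> range (\<lambda>w. bracket w (coeff x 0))"
proof (rule ccontr)
  define R where "R t = range (\<lambda>w. bracket w (poly_eval scaleC t x))" for t
  define R0 where "R0 = range (\<lambda>w. bracket w (coeff x 0))"
  define c where "c = coeff (poly_bracket bracket y x) n"
  assume "coeff (poly_bracket bracket y x) n \<notin> range (\<lambda>w. bracket w (coeff x 0))"
  then have "c \<notin> R0"
    by (simp add: c_def R0_def)
  obtain F where F: "finite F" "span F = UNIV"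
    using fin_dim by auto
  have sub: "subspace (range (\<lambda>w. bracket w z))" for z
    using linear_left[of z] subspace_UNIV
    by (metis Vector_Spaces.linear_def module_hom.subspace_image)
  obtain D where D: "D \<subseteq> R0" "independent D" "R0 \<subseteq> span D"
    by (rule maximal_independent_subset)
  have "span D = R0"
    using span_subspace[OF D(1,3)] sub by (simp add: R0_def)
  then have indep: "independent (insert c D)" and "c \<notin> D"
    using independent_insertI[OF _ D(2)] \<open>c \<notin> R0\<close> D(1) by auto
  have fin: "finite (insert c D)"
    using independent_span_bound[OF F(1) D(2)] F(2) by auto
  have "\<forall>d\<in>D. \<exists>w. d = bracket w (coeff x 0)"
    using D(1) by (auto simp: R0_def)
  then obtain w where w: "\<And>d. d \<in> D \<Longrightarrow> bracket (w d) (coeff x 0) = d"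
    by metis
  \<comment> \<open>A polynomial through \<open>v\<close> at \<open>t = 0\<close> whose value at each \<open>t \<noteq> 0\<close> is in \<open>R t\<close>; for \<open>c\<close> this requires division by \<open>t^n\<close>.\<close>
  define p where "p v = (if v = c then poly_shift n (poly_bracket bracket y x)
      else poly_bracket bracket (monom (w v) 0) x)" for v
  have "coeff (p v) 0 = v" if "v \<in> insert c D" for v
    using that w by (auto simp: p_def coeff_poly_shift c_def coeff_poly_bracket)
  from exists_independent_poly_eval[OF vector_space_axioms fin indep, of p, OF this]
  obtain t where t: "t \<noteq> 0" "inj_on (\<lambda>v. poly_eval scaleC t (p v)) (insert c D)"
    "independent ((\<lambda>v. poly_eval scaleC t (p v)) ` insert c D)"
    by auto
  have "poly_eval scaleC t (p v) \<in> R t" for v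
  proof (cases "v = c")
    case True
    have "bracket (poly_eval scaleC t y) (poly_eval scaleC t x) = scaleC (t ^ n) (poly_eval scaleC t (p v))"
      using poly_eval_poly_shift[OF zero, of n t] by (simp add: bracket_poly_eval p_def True)
    then have "bracket (scaleC (inverse (t ^ n)) (poly_eval scaleC t y)) (poly_eval scaleC t x)
        = poly_eval scaleC t (p v)"
      using t(1) by (simp add: bracket_scale)
    then show ?thesis
      unfolding R_def by (metis rangeI)
  qed (simp add: p_def bracket_poly_eval R_def)
  then have image: "(\<lambda>v. poly_eval scaleC t (p v)) ` insert c D \<subseteq> R t"
    by auto
  obtain E where E: "E \<subseteq> R t" "independent E" "R t \<subseteq> span E" "card E = dim (R t)"
    by (rule basis_exists)
  have "finite E"
    using independent_span_bound[OF F(1) E(2)] F(2) by simp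
  then have "card ((\<lambda>v. poly_eval scaleC t (p v)) ` insert c D) \<le> dim (R t)"
    using independent_span_bound[OF _ t(3) subset_trans[OF image E(3)]] E(4) by simp
  then have "card D + 1 \<le> dim (R t)"
    using card_image[OF t(2)] fin \<open>c \<notin> D\<close> by simp
  moreover have "card D = dim R0"
    using dim_unique[OF D(1,3,2)] by simp
  moreover have "dim (lie_centralizer UNIV bracket (coeff x 0))
      \<le> dim (lie_centralizer UNIV bracket (poly_eval scaleC t x))"
    using reg by (simp add: regular_element_def)
  ultimately show False
    using dim_range_add_dim_centralizer[of "coeff x 0"]
      dim_range_add_dim_centralizer[of "poly_eval scaleC t x"]
    by (simp add: R_def R0_def)
qed

text \<open>
  Coefficients are added one at a time. The next coefficient of \<open>[y, x]\<close> is \<open>[w, x\<^sub>0]\<close> for some \<open>w\<close>, by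
  the preceding lemma, and is cancelled by subtracting \<open>w\<close> in the next degree of \<open>y\<close>.
\<close>

lemma regular_centralizer_lift:
  assumes reg: "regular_element scaleC bracket (coeff x 0)"
    and v: "bracket v (coeff x 0) = 0"
  shows "\<exists>y \<in> truncated_centralizer (Suc n) x. coeff y 0 = v"
proof (induction n)
  case 0
  have "monom v 0 \<in> truncated_centralizer (Suc 0) x"
    using v by (simp add: truncated_centralizer_def coeff_poly_bracket)
  then show ?case
    by (intro bexI[of _ "monom v 0"]) auto
next
  case (Suc n)
  then obtain y where y: "y \<in> truncated_centralizer (Suc n) x" "coeff y 0 = v"
    by auto
  then obtain w where w: "coeff (poly_bracket bracket y x) (Suc n) = bracket w (coeff x 0)"
    using regular_obstruction_in_range[OF reg, of "Suc n" y]
    by (auto simp: truncated_centralizer_def)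
  have bm: "coeff (poly_bracket bracket (monom w m) x) k =
      (if m \<le> k then bracket w (coeff x (k - m)) else 0)" for m k
  proof -
    have "coeff (poly_bracket bracket (monom w m) x) k =
        (\<Sum>i\<le>k. if i = m then bracket w (coeff x (k - m)) else 0)"
      unfolding coeff_poly_bracket by (intro sum.cong) auto
    then show ?thesis
      by simp
  qed
  have bd: "coeff (poly_bracket bracket (y - monom w m) x) k =
      coeff (poly_bracket bracket y x) k - coeff (poly_bracket bracket (monom w m) x) k" for m k
  proof -
    interpret P: lie_algebra "poly_scale scaleC" "poly_bracket bracket"
      by (rule poly_lie_algebra)
    show ?thesis
      by (metis P.bracket_add(1) add_diff_cancel_right' coeff_diff diff_add_cancel)
  qed
  \<comment> \<open>Up to degree \<open>n + 1\<close>, subtracting \<open>w T^(n+1)\<close> changes \<open>[y, x]\<close> only by \<open>[w, x\<^sub>0]\<close> in degree \<open>n + 1\<close>.\<close>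
  have "y - monom w (Suc n) \<in> truncated_centralizer (Suc (Suc n)) x"
    using y(1) w by (auto simp: truncated_centralizer_def bd bm less_Suc_eq)
  then show ?case
    using y(2) by (intro bexI[of _ "y - monom w (Suc n)"]) auto
qed

lemma takiff_subset_finite_span:
  "\<exists>F. finite F \<and> {y. \<forall>k\<ge>n. coeff y k = 0} \<subseteq> module.span (poly_scale scaleC) F"
proof -
  interpret P: lie_algebra "poly_scale scaleC" "poly_bracket bracket"
    by (rule poly_lie_algebra)
  obtain B where B: "finite B" "span B = UNIV"
    using fin_dim by auto
  let ?F = "\<Union>k<n. (\<lambda>b. monom b k) ` B"
  have "y \<in> P.span ?F" if y: "\<forall>k\<ge>n. coeff y k = 0" for y
  proof -
    have "monom v k \<in> P.span ?F" if "k < n" for v k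
    proof -
      interpret L: Vector_Spaces.linear scaleC "poly_scale scaleC" "\<lambda>v. monom v k"
        by unfold_locales (auto simp: poly_eq_iff coeff_poly_scale)
      have "monom v k \<in> (\<lambda>v. monom v k) ` span B"
        using B(2) by simp
      then have "monom v k \<in> P.span ((\<lambda>v. monom v k) ` B)"
        by (simp add: L.span_image)
      then show ?thesis
        using P.span_mono[of "(\<lambda>v. monom v k) ` B" ?F] that by blast
    qed
    then have "(\<Sum>k<n. monom (coeff y k) k) \<in> P.span ?F"
      by (intro P.span_sum) auto
    moreover have "y = (\<Sum>k<n. monom (coeff y k) k)"
      using y by (auto simp: poly_eq_iff coeff_sum)
    ultimately show ?thesis
      by simp
  qed
  moreover have "finite ?F"
    using B(1) by auto
  ultimately show ?thesis
    by blast
qed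

text \<open>
  Rank-nullity for the constant term: its image is the whole centralizer of \<open>x\<^sub>0\<close> by
  \<open>regular_centralizer_lift\<close>, and its kernel is a shifted copy of the annihilator one order lower.
\<close>

lemma dim_truncated_centralizer:
  assumes reg: "regular_element scaleC bracket (coeff x 0)"
  shows "vector_space.dim (poly_scale scaleC) (truncated_centralizer n x) =
    n * dim (lie_centralizer UNIV bracket (coeff x 0))"
proof -
  interpret P: lie_algebra "poly_scale scaleC" "poly_bracket bracket"
    by (rule poly_lie_algebra)
  interpret PP: vector_space_pair "poly_scale scaleC" "poly_scale scaleC"
    by unfold_locales
  interpret PV: vector_space_pair "poly_scale scaleC" scaleC
    by unfold_locales
  have sub: "P.subspace (truncated_centralizer n x)" for n
    by (auto simp: P.subspace_def truncated_centralizer_def P.bracket_add P.bracket_scale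
        coeff_poly_scale)
  have fin: "\<exists>F. finite F \<and> truncated_centralizer n x \<subseteq> P.span F" for n
    using takiff_subset_finite_span[of n] by (auto simp: truncated_centralizer_def)
  have coeff_0: "Vector_Spaces.linear (poly_scale scaleC) scaleC (\<lambda>y. coeff y 0)"
    by unfold_locales (auto simp: coeff_poly_scale)
  have shift: "Vector_Spaces.linear (poly_scale scaleC) (poly_scale scaleC) (pCons 0)"
    by unfold_locales (auto simp: poly_eq_iff coeff_poly_scale coeff_pCons split: nat.split)
  have dim_0: "P.dim {0} = 0"
    using P.dim_le_card[of "{0}" "{}"] by simp
  show ?thesis
  proof (induction n)
    case 0
    then show ?case
      by (simp add: truncated_centralizer_0 dim_0)
  next
    case (Suc n)
    have image: "(\<lambda>y. coeff y 0) ` truncated_centralizer (Suc n) x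
        = lie_centralizer UNIV bracket (coeff x 0)"
    proof (intro equalityI subsetI)
      fix v assume "v \<in> (\<lambda>y. coeff y 0) ` truncated_centralizer (Suc n) x"
      then show "v \<in> lie_centralizer UNIV bracket (coeff x 0)"
        by (auto simp: truncated_centralizer_def lie_centralizer_def coeff_poly_bracket
            dest: spec[of _ 0])
    next
      fix v assume "v \<in> lie_centralizer UNIV bracket (coeff x 0)"
      then show "v \<in> (\<lambda>y. coeff y 0) ` truncated_centralizer (Suc n) x"
        using regular_centralizer_lift[OF reg, of v n] by (auto simp: lie_centralizer_def)
    qed
    have "P.dim (pCons 0 ` truncated_centralizer n x) = P.dim (truncated_centralizer n x)"
    proof -
      have "{y \<in> truncated_centralizer n x. pCons 0 y = 0} = {0}"
        using P.subspace_0[OF sub] by auto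
      then show ?thesis
        using fin[of n] PP.dim_image_add_dim_kernel[OF shift sub[of n]] by (auto simp: dim_0)
    qed
    moreover obtain F where "finite F" "truncated_centralizer (Suc n) x \<subseteq> P.span F"
      using fin by blast
    ultimately show ?case
      using PV.dim_image_add_dim_kernel[OF coeff_0 sub[of "Suc n"]] Suc.IH
      by (simp add: image truncated_centralizer_kernel_coeff_0)
  qed
qed

lemma takiff_centralizer_dim_regular:
  assumes "regular_element scaleC bracket (coeff x 0)"
  shows "takiff_centralizer_dim scaleC bracket n x =
    Suc n * dim (lie_centralizer UNIV bracket (coeff x 0))"
proof -
  have "coeff (poly_bracket bracket y (takiff_proj n x)) k = coeff (poly_bracket bracket y x) k"
    if "k \<le> n" for y k
    using that by (auto simp: coeff_poly_bracket coeff_takiff_proj intro!: sum.cong)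
  then have "lie_centralizer (takiff n) (takiff_bracket n bracket) (takiff_proj n x)
      = truncated_centralizer (Suc n) x"
    by (auto simp: lie_centralizer_def truncated_centralizer_def mem_takiff_iff Suc_le_eq
        less_Suc_eq_le takiff_bracket_def takiff_proj_kernel)
  then show ?thesis
    using dim_truncated_centralizer[OF assms, of "Suc n"]
    by (simp add: takiff_centralizer_dim_def)
qed

section \<open>The index of a quadratic Lie algebra\<close>

text \<open>
  The form identifies \<open>\<g>\<close> with its dual, and invariance turns the stabilizer of \<open>K(u, -)\<close> into the
  centralizer of \<open>u\<close>. Hence the index is the least dimension of a centralizer.
\<close>

lemma quadratic_lie_index:
  assumes "quadratic scaleC bracket" and reg: "regular_element scaleC bracket z"
  shows "lie_index scaleC bracket = dim (lie_centralizer UNIV bracket z)"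
proof -
  obtain K :: "'a \<Rightarrow> 'a \<Rightarrow> complex" where
    K_left: "\<And>y. Vector_Spaces.linear scaleC (*) (\<lambda>x. K x y)" and
    K_right: "\<And>x. Vector_Spaces.linear scaleC (*) (K x)" and
    K_sym: "\<And>x y. K x y = K y x" and
    nondeg: "\<And>x. (\<forall>y. K x y = 0) \<Longrightarrow> x = 0" and
    inv: "\<And>x y z. K (bracket x y) z = K x (bracket y z)"
    using assms(1) unfolding quadratic_def by blast
  interpret C: vector_space "(*) :: complex \<Rightarrow> complex \<Rightarrow> complex"
    by unfold_locales (auto simp: algebra_simps)
  interpret VC: vector_space_pair scaleC "(*) :: complex \<Rightarrow> complex \<Rightarrow> complex"
    by unfold_locales
  obtain F where F: "finite F" "span F = UNIV"
    using fin_dim by auto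
  obtain B where B: "independent B" "UNIV \<subseteq> span B"
    by (rule maximal_independent_subset)
  then have finB: "finite B"
    using independent_span_bound[OF F(1) B(1)] F(2) by auto
  interpret fd: finite_dimensional_vector_space scaleC B
    using B finB by unfold_locales auto
  \<comment> \<open>In coordinates with respect to \<open>B\<close> this is the map from \<open>\<g>\<close> to its dual; as an endomorphism of \<open>\<g>\<close> it is onto once it is injective.\<close>
  define \<Phi> where "\<Phi> u = (\<Sum>b\<in>B. scaleC (K u b) b)" for u
  have lin: "Vector_Spaces.linear scaleC scaleC \<Phi>"
    unfolding \<Phi>_def using K_left
    by (auto simp: Vector_Spaces.linear_iff scale_left_distrib sum.distrib scale_sum_right
        vector_space_axioms)
  have B_coeffs: "\<forall>b\<in>B. a b = 0" if "(\<Sum>b\<in>B. scaleC (a b) b) = 0" for a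
    using that B(1) finB by (auto simp: dependent_finite)
  have "u = 0" if "\<Phi> u = 0" for u
  proof (rule nondeg, intro allI)
    fix y
    have "\<forall>b\<in>B. K u b = 0"
      using that B_coeffs by (simp add: \<Phi>_def)
    then show "K u y = 0"
      using VC.linear_eq_0_on_span[OF K_right, of B u y] B(2) by auto
  qed
  then have "inj \<Phi>"
    using module_hom.inj_on_iff_eq_0[OF Vector_Spaces.linear.axioms(3)[OF lin] subspace_UNIV] by auto
  then have "surj \<Phi>"
    by (rule fd.linear_inj_imp_surj[OF lin])
  have represent: "\<exists>u. f = K u" if f: "Vector_Spaces.linear scaleC (*) f" for f
  proof -
    obtain u where "\<Phi> u = (\<Sum>b\<in>B. scaleC (f b) b)"
      using \<open>surj \<Phi>\<close> by (metis surjD)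
    then have "(\<Sum>b\<in>B. scaleC (K u b - f b) b) = 0"
      by (simp add: \<Phi>_def scale_left_diff_distrib sum_subtractf)
    then have "f b = K u b" if "b \<in> B" for b
      using B_coeffs[of "\<lambda>b. K u b - f b"] that by auto
    then have "f y = K u y" for y
      using VC.linear_eq_on[OF f K_right, of y B u] B(2) by auto
    then show ?thesis
      by blast
  qed
  have stabilizer: "coadjoint_stabilizer bracket (K u) = lie_centralizer UNIV bracket u" for u
  proof -
    have "(\<forall>w. K u (bracket y w) = 0) \<longleftrightarrow> bracket y u = 0" for y
    proof
      assume "\<forall>w. K u (bracket y w) = 0"
      then have "bracket u y = 0"
        by (intro nondeg) (simp add: inv)
      then show "bracket y u = 0"
        using bracket_minus[of y u] by simp
    next
      assume "bracket y u = 0"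
      then have "bracket u y = 0"
        using bracket_minus[of u y] by simp
      then show "\<forall>w. K u (bracket y w) = 0"
        using VC.linear_0[OF K_left] by (simp add: inv[symmetric])
    qed
    then show ?thesis
      by (auto simp: coadjoint_stabilizer_def lie_centralizer_def)
  qed
  have "{f. Vector_Spaces.linear scaleC (*) f} = range K"
    using represent K_right by auto
  then have "lie_index scaleC bracket = (INF u. dim (lie_centralizer UNIV bracket u))"
    by (simp add: lie_index_def image_image stabilizer)
  also have "\<dots> = dim (lie_centralizer UNIV bracket z)"
    using reg by (intro cInf_eq_minimum) (auto simp: regular_element_def)
  finally show ?thesis .
qed

end

section \<open>Modalities\<close>

theorem theorem1p7:
  fixes scaleC :: "complex \<Rightarrow> 'a::ab_group_add \<Rightarrow> 'a"
    and bracket :: "'a \<Rightarrow> 'a \<Rightarrow> 'a"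
    and x :: "'a poly"
  assumes "fin_dim_lie_algebra scaleC bracket"
    and "quadratic scaleC bracket"
    and "regular_element scaleC bracket (coeff x 0)"
  shows "\<forall>m n. m \<le> n \<longrightarrow>
    modality scaleC bracket m n x = (int n - int m) * int (lie_index scaleC bracket)"
proof (intro allI impI)
  fix m n :: nat
  interpret fin_dim_lie_algebra scaleC bracket
    by (rule assms(1))
  let ?\<chi> = "lie_index scaleC bracket" and ?Y = "{y. takiff_proj m y = takiff_proj m x}"
  have dim: "takiff_centralizer_dim scaleC bracket k y = Suc k * ?\<chi>"
    if "coeff y 0 = coeff x 0" for y k
    using takiff_centralizer_dim_regular[of y k] quadratic_lie_index assms(2,3) that by simp
  have "takiff_centralizer_dim scaleC bracket n ` ?Y = {Suc n * ?\<chi>}"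
  proof -
    have "takiff_centralizer_dim scaleC bracket n y = Suc n * ?\<chi>" if "y \<in> ?Y" for y
      using that by (intro dim) (auto simp: takiff_proj_eq_iff)
    then show ?thesis
      by (auto intro!: image_eqI[of _ _ x])
  qed
  then have "modality scaleC bracket m n x = int (Suc n * ?\<chi>) - int (Suc m * ?\<chi>)"
    by (simp add: modality_def dim)
  then show "modality scaleC bracket m n x = (int n - int m) * int ?\<chi>"
    by (simp add: algebra_simps)
qed

end
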